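(* Let $\mathcal{I}$ and $\mathcal{N}$ be the probabilistic intersection operator and the probabilistic negation operator on Beta embeddings (as defined in the context). Then: 1. For every Beta embedding $\mathbf{S}$, $\mathbf{S}$ is a fixed point of $\mathcal{N}\circ\mathcal{N}$, i.e. $\mathcal{N}(\mathcal{N}(\mathbf{S}))=\mathbf{S}$. 2. For every Beta embedding $\mathbf{S}$ and every number $m\ge 1$ of copies of $\mathbf{S}$, $\mathcal{I}(\{\mathbf{S},\mathbf{S},\dots,\mathbf{S}\})=\mathbf{S}$, where $\mathcal{I}$ is applied to the $m$ inputs $\mathbf{S}_1=\dots=\mathbf{S}_m=\mathbf{S}$.
   Context: Beta embeddings. Fix a dimension $d\ge 1$. A Beta embedding is a tuple $\mathbf{S}=[(\alpha_1,\beta_1),\dots,(\alpha_d,\beta_d)]$ of pairs of positive real numbers; it represents $d$ independent Beta distributions. The $k$-th one has probability density function $p_{\mathbf{S},k}(x)=\frac{x^{\alpha_k-1}(1-x)^{\beta_k-1}}{\mathrm{B}(\alpha_k,\beta_k)}$ for $x$ in the interval $[0,1]$, where $\mathrm{B}$ is the beta function. All operators below act separately on each of the $d$ coordinates, so one may write them for $d=1$, $\mathbf{S}=[(\alpha,\beta)]$ with density $p_{\mathbf{S}}$. Negation operator. $\mathcal{N}([(\alpha,\beta)])=[(\tfrac1\alpha,\tfrac1\beta)]$ (coordinatewise when $d>1$). Intersection operator. Fix a real-valued function $\mathrm{MLP}_{\mathrm{Att}}$ on Beta embeddings (a neural network taking the parameters of an embedding as input and returning a single real scalar; it is arbitrary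 but fixed). The operator $\mathcal{I}$ takes a finite collection $\{\mathbf{S}_1,\dots,\mathbf{S}_m\}$, $m\ge1$, of input Beta embeddings, with repetitions allowed (the inputs form a list/multiset, not a set in which duplicates are merged). Put $$w_i=\frac{\exp(\mathrm{MLP}_{\mathrm{Att}}(\mathbf{S}_i))}{\sum_{j=1}^m\exp(\mathrm{MLP}_{\mathrm{Att}}(\mathbf{S}_j))},\qquad i=1,\dots,m,$$ so that $w_i>0$ and $\sum_i w_i=1$. Then $\mathcal{I}(\{\mathbf{S}_1,\dots,\mathbf{S}_m\})$ is the Beta embedding whose density is the normalized weighted product $\frac1Z\,p_{\mathbf{S}_1}^{w_1}\cdots p_{\mathbf{S}_m}^{w_m}$, where $Z$ is the normalization constant (coordinatewise when $d>1$, with the same weights in every coordinate). In terms of parameters, if $\mathbf{S}_i=[(\alpha_i,\beta_i)]$, then $\mathcal{I}(\{\mathbf{S}_1,\dots,\mathbf{S}_m\})=[(\sum_i w_i\alpha_i,\ \sum_i w_i\beta_i)]$. Equality of Beta embeddings means equality of all their parameters. *)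

theory Defs
  imports "HOL-Analysis.Analysis"
begin

typedef (overloaded) 'd beta_embedding =
  "{S :: (real \<times> real) ^ ('d::finite). \<forall>k. fst (S $ k) > 0 \<and> snd (S $ k) > 0}"
  morphisms beta_params Beta_embedding
proof -
  have "(\<chi> k. (1, 1)) \<in> {S :: (real \<times> real) ^ 'd. \<forall>k. fst (S $ k) > 0 \<and> snd (S $ k) > 0}"
    by simp
  then show ?thesis by blast
qed

setup_lifting type_definition_beta_embedding

definition alpha :: "'d::finite beta_embedding \<Rightarrow> 'd \<Rightarrow> real" where
  "alpha S k = fst (beta_params S $ k)"

definition beta :: "'d::finite beta_embedding \<Rightarrow> 'd \<Rightarrow> real" where
  "beta S k = snd (beta_params S $ k)"

lemma alpha_pos [simp]: "alpha S k > 0" and beta_pos [simp]: "beta S k > 0"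
  using beta_params[of S] by (auto simp: alpha_def beta_def)

lemma beta_embedding_eqI:
  assumes "\<And>k. alpha S k = alpha T k" and "\<And>k. beta S k = beta T k"
  shows "S = T"
  using assms by (simp add: alpha_def beta_def beta_params_inject [symmetric] vec_eq_iff prod_eq_iff)

(* Meaningful for x in the open interval (0,1).  At the end points the density may be infinite,
   whereas 0 powr a = 0 for every a; densities are therefore only ever compared on (0,1). *)
definition beta_density :: "'d::finite beta_embedding \<Rightarrow> 'd \<Rightarrow> real \<Rightarrow> real" where
  "beta_density S k x =
     x powr (alpha S k - 1) * (1 - x) powr (beta S k - 1) / Beta (alpha S k) (beta S k)"

lift_definition beta_negation :: "'d::finite beta_embedding \<Rightarrow> 'd beta_embedding" is
  "\<lambda>S. \<chi> k. (1 / fst (S $ k), 1 / snd (S $ k))"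
  by simp

definition attention_weight ::
  "('d::finite beta_embedding \<Rightarrow> real) \<Rightarrow> 'd beta_embedding list \<Rightarrow> nat \<Rightarrow> real" where
  "attention_weight MLP Ss i = exp (MLP (Ss ! i)) / (\<Sum>j<length Ss. exp (MLP (Ss ! j)))"

definition weighted_product ::
  "('d::finite beta_embedding \<Rightarrow> real) \<Rightarrow> 'd beta_embedding list \<Rightarrow> 'd \<Rightarrow> real \<Rightarrow> real" where
  "weighted_product MLP Ss k x =
     (\<Prod>i<length Ss. beta_density (Ss ! i) k x powr attention_weight MLP Ss i)"

(* The embedding with density (1/Z) * weighted_product.  For a nonempty list it exists and is
   unique, with parameters as in alpha_beta_intersection below. *)
definition beta_intersection ::
  "('d::finite beta_embedding \<Rightarrow> real) \<Rightarrow> 'd beta_embedding list \<Rightarrow> 'd beta_embedding" where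
  "beta_intersection MLP Ss =
     (THE T. \<forall>k. \<forall>x\<in>{0<..<1}. beta_density T k x =
        weighted_product MLP Ss k x / integral {0..1} (weighted_product MLP Ss k))"

lemma sum_attention_weight:
  assumes "Ss \<noteq> []"
  shows "(\<Sum>i<length Ss. attention_weight MLP Ss i) = 1"
proof -
  have "(\<Sum>j<length Ss. exp (MLP (Ss ! j))) > 0"
    using assms by (intro sum_pos) auto
  then show ?thesis
    by (simp add: attention_weight_def sum_divide_distrib [symmetric])
qed

lemma attention_weight_pos:
  assumes "Ss \<noteq> []"
  shows "attention_weight MLP Ss i > 0"
proof -
  have "(\<Sum>j<length Ss. exp (MLP (Ss ! j))) > 0"
    using assms by (intro sum_pos) auto
  then show ?thesis by (simp add: attention_weight_def)
qed

lemma Beta_pos_real: "a > 0 \<Longrightarrow> b > 0 \<Longrightarrow> Beta a b > (0::real)"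
  by (simp add: Beta_def Gamma_real_pos)

lemma beta_density_inject:
  assumes eq: "\<And>k x. x \<in> {0<..<1} \<Longrightarrow> beta_density S k x = beta_density T k x"
  shows "S = T"
proof -
  have "alpha S k = alpha T k \<and> beta S k = beta T k" for k
  proof -
    let ?L = "\<lambda>S x. (alpha S k - 1) * ln x + (beta S k - 1) * ln (1 - x)
                     - ln (Beta (alpha S k) (beta S k))"
    have ln_dens: "ln (beta_density S k x) = ?L S x" if "0 < x" "x < 1" for S :: "'a beta_embedding" and x
      using that Beta_pos_real[of "alpha S k" "beta S k"]
      by (simp add: beta_density_def ln_mult ln_div ln_powr)
    have L: "?L S x = ?L T x" if "0 < x" "x < 1" for x
      using that ln_dens eq[of x k] by (metis greaterThanLessThan_iff)
    define p q r where "p = alpha S k - alpha T k" and "q = beta S k - beta T k"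
      and "r = ln (Beta (alpha S k) (beta S k)) - ln (Beta (alpha T k) (beta T k))"
    have D: "p * ln x + q * ln (1 - x) = r" if "0 < x" "x < 1" for x
      using L[OF that] by (simp add: p_def q_def r_def algebra_simps)
    have l4: "ln (4::real) = 2 * ln 2"
      using ln_powr[of 2 "2::real"] by simp
    have half: "ln (1/2::real) = - ln 2" and quarter: "ln (1/4::real) = - 2 * ln 2"
      and three: "ln (3/4::real) = ln 3 - 2 * ln 2"
      by (simp_all add: ln_div l4)
    have e1: "p * (- ln 2) + q * (- ln 2) = r" using D[of "1/2"] half by simp
    have e2: "p * (- 2 * ln 2) + q * (ln 3 - 2 * ln 2) = r"
      using D[of "1/4"] unfolding quarter three by (simp add: quarter three)
    have e3: "p * (ln 3 - 2 * ln 2) + q * (- 2 * ln 2) = r"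
      using D[of "3/4"] by (simp add: quarter three)
    have "(q - p) * ln 3 = 0" using e2 e3 by (simp add: algebra_simps)
    then have qp: "q = p" by simp
    have "p * (ln 3 - 2 * ln 2) = 0" using e1 e2 unfolding qp by (simp add: algebra_simps)
    moreover have "ln (3::real) < 2 * ln 2" unfolding l4 [symmetric] by simp
    ultimately have "p = 0" by simp
    then show ?thesis using qp by (simp add: p_def q_def)
  qed
  then show ?thesis by (intro beta_embedding_eqI) auto
qed

lemma alpha_beta_intersection:
  assumes ne: "Ss \<noteq> []"
  shows "alpha (beta_intersection MLP Ss) k = (\<Sum>i<length Ss. attention_weight MLP Ss i * alpha (Ss ! i) k)"
    and "beta (beta_intersection MLP Ss) k = (\<Sum>i<length Ss. attention_weight MLP Ss i * beta (Ss ! i) k)"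
proof -
  define w where "w = attention_weight MLP Ss"
  define a b where "a = (\<lambda>k. \<Sum>i<length Ss. w i * alpha (Ss ! i) k)"
    and "b = (\<lambda>k. \<Sum>i<length Ss. w i * beta (Ss ! i) k)"
  define T where "T = Beta_embedding (\<chi> k. (a k, b k))"
  have w: "w i > 0" "(\<Sum>i<length Ss. w i) = 1" for i
    using attention_weight_pos[OF ne] sum_attention_weight[OF ne] by (auto simp: w_def)
  have pos: "a k > 0" "b k > 0" for k
    unfolding a_def b_def using ne w by (auto intro!: sum_pos mult_pos_pos)
  have T: "alpha T k = a k" "beta T k = b k" for k
    using pos by (simp_all add: T_def alpha_def beta_def Beta_embedding_inverse)
  have dens: "beta_density T k x =
      weighted_product MLP Ss k x / integral {0..1} (weighted_product MLP Ss k)"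
    if x: "x \<in> {0<..<1}" for k x
  proof -
    define C where "C = (\<Prod>i<length Ss. Beta (alpha (Ss ! i) k) (beta (Ss ! i) k) powr w i)"
    have C: "C > 0" unfolding C_def
      by (intro prod_pos) (simp add: Beta_pos_real less_imp_neq [symmetric])
    have wp: "weighted_product MLP Ss k y = y powr (a k - 1) * (1 - y) powr (b k - 1) / C"
      if y: "y \<in> {0<..<1}" for y
    proof -
      have "beta_density (Ss ! i) k y powr w i =
          y powr (w i * alpha (Ss ! i) k - w i) * (1 - y) powr (w i * beta (Ss ! i) k - w i)
           / Beta (alpha (Ss ! i) k) (beta (Ss ! i) k) powr w i" for i
        using y Beta_pos_real[of "alpha (Ss ! i) k" "beta (Ss ! i) k"]
        by (simp add: beta_density_def powr_mult powr_divide powr_powr algebra_simps)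
      moreover have "(\<Prod>i<length Ss. z powr f i) = z powr (\<Sum>i<length Ss. f i)" if "z > 0"
        for z :: real and f :: "nat \<Rightarrow> real"
        using that by (simp add: powr_sum)
      ultimately show ?thesis using y w(2)
        by (simp add: weighted_product_def w_def [symmetric] prod.distrib prod_dividef C_def
            sum_subtractf a_def b_def)
    qed
    have "((\<lambda>y. y powr (a k - 1) * (1 - y) powr (b k - 1) / C) has_integral
        Beta (a k) (b k) / C) {0..1}"
      by (intro has_integral_divide has_integral_Beta_real pos)
    then have "(weighted_product MLP Ss k has_integral Beta (a k) (b k) / C) {0..1}"
      by (rule has_integral_spike_finite[of "{0, 1}", rotated 2]) (auto simp: wp)
    then have "integral {0..1} (weighted_product MLP Ss k) = Beta (a k) (b k) / C"
      by (rule integral_unique)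
    then show ?thesis using C by (simp add: wp[OF x] beta_density_def T)
  qed
  have "beta_intersection MLP Ss = T" unfolding beta_intersection_def
  proof (rule the_equality)
    fix T' assume T': "\<forall>k. \<forall>x\<in>{0<..<1}. beta_density T' k x =
        weighted_product MLP Ss k x / integral {0..1} (weighted_product MLP Ss k)"
    show "T' = T" by (rule beta_density_inject) (simp add: dens T')
  qed (use dens in blast)
  then show "alpha (beta_intersection MLP Ss) k = (\<Sum>i<length Ss. attention_weight MLP Ss i * alpha (Ss ! i) k)"
    and "beta (beta_intersection MLP Ss) k = (\<Sum>i<length Ss. attention_weight MLP Ss i * beta (Ss ! i) k)"
    by (simp_all add: T a_def b_def w_def)
qed

end

theory Submission
  imports Defs
begin

text \<open>Negation inverts each parameter, and taking reciprocals twice is the identity. By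
  \<open>alpha_beta_intersection\<close>, intersection takes weighted averages of the parameters,
  and an average of equal values is that value because the weights sum to 1, whatever
  \<open>MLP\<close> is.\<close>

lemma beta_negation_involutive: "beta_negation (beta_negation S) = S"
  by transfer (simp add: vec_eq_iff)

lemma beta_intersection_replicate:
  assumes "m \<ge> 1"
  shows "beta_intersection MLP (replicate m S) = S"
proof -
  have ne: "replicate m S \<noteq> []"
    using assms by simp
  \<comment> \<open>Only the total weight matters, not that each weight is 1/m. The bound is
    \<open>m\<close>, the form to which simp reduces the length of the list.\<close>
  have weights: "(\<Sum>i<m. attention_weight MLP (replicate m S) i) = 1"
    using sum_attention_weight[OF ne, of MLP] by simp
  show ?thesis
  proof (rule beta_embedding_eqI)
    fix k
    show "alpha (beta_intersection MLP (replicate m S)) k = alpha S k"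
      \<comment> \<open>All entries are \<open>S\<close>, so the common factor
        \<open>alpha S k\<close> leaves the sum.\<close>
      by (simp add: alpha_beta_intersection(1)[OF ne] weights flip: sum_distrib_right)
    show "beta (beta_intersection MLP (replicate m S)) k = beta S k"
      by (simp add: alpha_beta_intersection(2)[OF ne] weights flip: sum_distrib_right)
  qed
qed

theorem proposition1:
  fixes MLP :: "'d::finite beta_embedding \<Rightarrow> real"
  shows "(\<forall>S :: 'd beta_embedding. (beta_negation \<circ> beta_negation) S = S) \<and>
         (\<forall>(S :: 'd beta_embedding) (m :: nat). m \<ge> 1 \<longrightarrow>
            beta_intersection MLP (replicate m S) = S)"
  by (simp add: beta_negation_involutive beta_intersection_replicate)

end
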